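(* For any $\mathcal{H}\subseteq\mathcal{Y}^{\mathcal{X}}$, there exists an agnostic online learner whose expected regret over $T$ rounds, under bandit feedback, is at most $$8\sqrt{\operatorname{L}(\mathcal{H})\operatorname{BL}(\mathcal{H})\,T\log(T)}.$$
   Context: $\mathcal{X}$ is the instance space and $\mathcal{Y}$ the label space; no assumption is made on the size of $\mathcal{Y}$. $\operatorname{L}(\mathcal{H})$ and $\operatorname{BL}(\mathcal{H})$ are the Littlestone and Bandit Littlestone dimensions of $\mathcal{H}$, defined below. Bandit feedback game. An (oblivious) adversary fixes an arbitrary sequence $(x_1,y_1),\dots,(x_T,y_T)\in\mathcal{X}\times\mathcal{Y}$ in advance (agnostic setting: no relation to $\mathcal{H}$ is assumed). In each round $t\in\{1,\dots,T\}$ the learner sees $x_t$, makes a (possibly randomized) prediction $\hat y_t=\mathcal{A}(x_t)\in\mathcal{Y}$ depending on the history so far, and then observes only the bit $\mathbb{1}\{\hat y_t\neq y_t\}$ (not $y_t$). The expected regret of the learner $\mathcal{A}$ is $$R_{\mathcal{A}}(T,\mathcal{H}):=\sup_{(x_1,y_1),\dots,(x_T,y_T)}\Big(\mathbb{E}\Big[\sum_{t=1}^T\mathbb{1}\{\mathcal{A}(x_t)\neq y_t\}\Big]-\inf_{h\in\mathcal{H}}\sum_{t=1}^T\mathbb{1}\{h(x_t)\neq y_t\}\Big).$$ Trees. For a set $\mathcal{M}$, an $\mathcal{X}$-valued $\mathcal{M}$-ary tree of depth $d$ is a complete rooted tree in which each internal node is labeled by an element of $\mathcal{X}$ and has one outgoing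 edge for each $m\in\mathcal{M}$; it is identified with functions $\mathcal{T}_t:\mathcal{M}^{t-1}\to\mathcal{X}$, $t=1,\dots,d$, where $\mathcal{T}_t(m_{<t})$, $m_{<t}=(m_1,\dots,m_{t-1})$, is the label of the node reached by following edges $m_1,\dots,m_{t-1}$ from the root. Write $m_{\le t}=(m_1,\dots,m_t)$. Littlestone dimension $\operatorname{L}(\mathcal{H})$: the maximal depth $d$ of an $\mathcal{X}$-valued $\{\pm1\}$-ary tree $\mathcal{T}$ whose edges are labeled by elements $y(\sigma_{\le t})\in\mathcal{Y}$, with the two edges out of each node having different labels, such that for every $\sigma\in\{\pm1\}^d$ there is $h_\sigma\in\mathcal{H}$ with $h_\sigma(\mathcal{T}_t(\sigma_{<t}))=y(\sigma_{\le t})$ for all $t\le d$ (and $\operatorname{L}(\mathcal{H})=\infty$ if such trees exist of arbitrarily large depth). Bandit Littlestone dimension $\operatorname{BL}(\mathcal{H})$: the maximal depth $d$ of an $\mathcal{X}$-valued $\mathcal{Y}$-ary tree $\mathcal{T}$ such that for every path $y=(y_1,\dots,y_d)\in\mathcal{Y}^d$ there is $h_y\in\mathcal{H}$ with $h_y(\mathcal{T}_t(y_{<t}))\neq y_t$ for all $t\le d$ (and $\operatorname{BL}(\mathcal{H})=\infty$ if such trees exist of arbitrarily large depth).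
   Formalization: The number of rounds T is required to be at least 2: for T = 1 the bound is 0 since log 1 = 0, and the claim fails (two functions differing at one point, two labels: any learner has regret at least 1/2), while for T = 0 log(T) is undefined. *)

theory Defs
  imports "HOL-Probability.Probability"
begin

text \<open>
  An \<open>\<X>\<close>-valued tree with edges in \<open>'m\<close> is a function on paths: \<open>tr p\<close> is the label of
  the node reached from the root by following the edges \<open>p\<close>.  In a tree of depth \<open>d\<close> only
  the values at paths of length less than \<open>d\<close> matter.
\<close>

type_synonym ('m, 'x) tree = "'m list \<Rightarrow> 'x"

text \<open>
  The signs \<open>+1\<close> and \<open>-1\<close> are \<open>True\<close> and \<open>False\<close>.  The label of the last edge of a nonempty
  path \<open>p\<close> is \<open>lab p\<close>; rounds are counted from \<open>0\<close>.
\<close>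

definition littlestone_shattered ::
    "('x \<Rightarrow> 'y) set \<Rightarrow> nat \<Rightarrow> (bool, 'x) tree \<Rightarrow> (bool list \<Rightarrow> 'y) \<Rightarrow> bool" where
  "littlestone_shattered H d tr lab \<longleftrightarrow>
     (\<forall>p. length p < d \<longrightarrow> lab (p @ [True]) \<noteq> lab (p @ [False])) \<and>
     (\<forall>\<sigma>. length \<sigma> = d \<longrightarrow> (\<exists>h\<in>H. \<forall>t<d. h (tr (take t \<sigma>)) = lab (take (Suc t) \<sigma>)))"

definition bandit_shattered :: "('x \<Rightarrow> 'y) set \<Rightarrow> nat \<Rightarrow> ('y, 'x) tree \<Rightarrow> bool" where
  "bandit_shattered H d tr \<longleftrightarrow>
     (\<forall>ys. length ys = d \<longrightarrow> (\<exists>h\<in>H. \<forall>t<d. h (tr (take t ys)) \<noteq> ys ! t))"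

text \<open>
  For nonempty \<open>H\<close> depth \<open>0\<close> is always attained; for empty \<open>H\<close> both suprema are \<open>0\<close>.
\<close>

definition littlestone_dim :: "('x \<Rightarrow> 'y) set \<Rightarrow> enat" where
  "littlestone_dim H = Sup {enat d | d. \<exists>tr lab. littlestone_shattered H d tr lab}"

definition bandit_littlestone_dim :: "('x \<Rightarrow> 'y) set \<Rightarrow> enat" where
  "bandit_littlestone_dim H = Sup {enat d | d. \<exists>tr. bandit_shattered H d tr}"

text \<open>
  A round is recorded as (instance, prediction, feedback), where the feedback is \<open>True\<close> iff
  the prediction was wrong.  The true label is not part of the record, so a learner cannot
  use it.
\<close>

type_synonym ('x, 'y) history = "('x \<times> 'y \<times> bool) list"

type_synonym ('x, 'y) bandit_learner = "('x, 'y) history \<Rightarrow> 'x \<Rightarrow> 'y pmf"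

text \<open>
  The distribution of the complete history when the game is continued from \<open>hist\<close> on the
  remaining adversarial sequence.
\<close>

primrec play ::
    "('x, 'y) bandit_learner \<Rightarrow> ('x, 'y) history \<Rightarrow> ('x \<times> 'y) list \<Rightarrow> ('x, 'y) history pmf" where
  "play A hist [] = return_pmf hist"
| "play A hist (z # zs) =
     bind_pmf (A hist (fst z)) (\<lambda>y'. play A (hist @ [(fst z, y', y' \<noteq> snd z)]) zs)"

definition mistakes :: "('x, 'y) history \<Rightarrow> nat" where
  "mistakes hist = length (filter (\<lambda>(x, y', b). b) hist)"

definition expected_mistakes :: "('x, 'y) bandit_learner \<Rightarrow> ('x \<times> 'y) list \<Rightarrow> real" where
  "expected_mistakes A zs =
     measure_pmf.expectation (play A [] zs) (\<lambda>hist. real (mistakes hist))"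

definition hyp_loss :: "('x \<Rightarrow> 'y) \<Rightarrow> ('x \<times> 'y) list \<Rightarrow> nat" where
  "hyp_loss h zs = length (filter (\<lambda>(x, y). h x \<noteq> y) zs)"

definition expected_regret ::
    "('x, 'y) bandit_learner \<Rightarrow> nat \<Rightarrow> ('x \<Rightarrow> 'y) set \<Rightarrow> ereal" where
  "expected_regret A T H =
     (SUP zs\<in>{zs. length zs = T}.
        ereal (expected_mistakes A zs) - (INF h\<in>H. ereal (real (hyp_loss h zs))))"

text \<open>The square root on \<open>[0, \<infinity>]\<close>; values at negative arguments are irrelevant.\<close>

definition ereal_sqrt :: "ereal \<Rightarrow> ereal" where
  "ereal_sqrt a = (if a = \<infinity> then \<infinity> else ereal (sqrt (real_of_ereal a)))"

end

theory Submission
  imports Defs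
begin

text \<open>
  If some \<open>x\<close> had \<open>BL(H) + 2\<close> different labels \<open>h x\<close>, the constant tree at \<open>x\<close> of depth
  \<open>BL(H) + 1\<close> would be bandit-shattered; hence every instance has at most \<open>K = BL(H) + 1\<close>
  relevant labels. As in the agnostic full-information setting, the standard optimal algorithm
  follows any \<open>h \<in> H\<close> with at most \<open>L(H)\<close> mistakes, so hard-wiring the rounds of
  the mistakes together with the (index of the) correct label turns it into a family of
  \<open>N \<le> ((T + 1) * K) ^ L(H)\<close> deterministic experts, one of which agrees with \<open>h\<close>.
  Exponential weights with importance-weighted loss estimates (EXP4) over these experts has regret
  \<open>ln N / \<eta> + \<eta> * K * T / 2\<close>. Unless \<open>K \<ge> T\<close>, when the bound exceeds \<open>T\<close>, one has
  \<open>ln N \<le> 2 * L(H) * ln T\<close>, and \<open>\<eta> = sqrt (L(H) * ln T / (BL(H) * T))\<close> gives the claim.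
\<close>

subsection \<open>Exponential weights with bandit feedback\<close>

definition expert_pmf :: "'i set \<Rightarrow> ('i \<Rightarrow> real) \<Rightarrow> 'i pmf" where
  "expert_pmf I w = embed_pmf (\<lambda>i. if i \<in> I then w i / sum w I else 0)"

lemma pmf_expert_pmf:
  assumes "finite I" "I \<noteq> {}" "\<And>i. i \<in> I \<Longrightarrow> w i > 0"
  shows "pmf (expert_pmf I w) i = (if i \<in> I then w i / sum w I else 0)"
proof -
  have W: "sum w I > 0" using assms by (intro sum_pos) auto
  have "(\<integral>\<^sup>+ i. ennreal (if i \<in> I then w i / sum w I else 0) \<partial>count_space UNIV)
      = (\<Sum>i\<in>I. ennreal (if i \<in> I then w i / sum w I else 0))"
    using assms(1) by (intro nn_integral_count_space') auto
  also have "\<dots> = (\<Sum>i\<in>I. ennreal (w i / sum w I))" by simp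
  also have "\<dots> = ennreal (\<Sum>i\<in>I. w i / sum w I)"
    using assms(3) W by (intro sum_ennreal) (simp add: less_imp_le)
  also have "(\<Sum>i\<in>I. w i / sum w I) = 1"
    using W by (simp add: sum_divide_distrib[symmetric])
  finally show ?thesis
    unfolding expert_pmf_def using assms(3) W
    by (subst pmf_embed_pmf) (auto simp: less_imp_le)
qed

lemma set_expert_pmf:
  assumes "finite I" "I \<noteq> {}" "\<And>i. i \<in> I \<Longrightarrow> w i > 0"
  shows "set_pmf (expert_pmf I w) \<subseteq> I"
  using pmf_expert_pmf[of I w, OF assms] by (auto simp: set_pmf_eq split: if_splits)

text \<open>The probability that the learner predicts \<open>a\<close> when expert \<open>i\<close>
  recommends \<open>g i\<close>. It is the denominator of the importance-weighted losses.\<close>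

definition vote_mass :: "'i set \<Rightarrow> ('i \<Rightarrow> real) \<Rightarrow> ('i \<Rightarrow> 'y) \<Rightarrow> 'y \<Rightarrow> real" where
  "vote_mass I w g a = sum w {i \<in> I. g i = a} / sum w I"

lemma pmf_map_expert_pmf:
  assumes "finite I" "I \<noteq> {}" "\<And>i. i \<in> I \<Longrightarrow> w i > 0"
  shows "pmf (map_pmf g (expert_pmf I w)) a = vote_mass I w g a"
proof -
  have "pmf (map_pmf g (expert_pmf I w)) a = measure_pmf.prob (expert_pmf I w) (g -` {a})"
    by (simp add: pmf_map)
  also have "\<dots> = measure_pmf.prob (expert_pmf I w) {i \<in> I. g i = a}"
    using set_expert_pmf[of I w, OF assms] by (intro measure_prob_cong_0) (auto simp: set_pmf_eq)
  also have "\<dots> = (\<Sum>i\<in>{i \<in> I. g i = a}. w i / sum w I)"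
    using assms by (subst measure_measure_pmf_finite) (auto simp: pmf_expert_pmf)
  finally show ?thesis by (simp add: vote_mass_def sum_divide_distrib)
qed

text \<open>The difference of the two sides vanishes at \<open>0\<close>, and its derivative is
  nonnegative by \<open>1 + u \<le> exp u\<close>. An upper bound on \<open>x\<close> would not do,
  since importance-weighted losses can be arbitrarily large.\<close>

lemma exp_minus_le_quadratic:
  fixes x :: real
  assumes "x \<ge> 0"
  shows "exp (- x) \<le> 1 - x + x\<^sup>2 / 2"
proof -
  let ?f = "\<lambda>x::real. 1 - x + x\<^sup>2 / 2 - exp (- x)"
  have "?f 0 \<le> ?f x"
  proof (rule DERIV_nonneg_imp_nondecreasing[OF assms])
    fix z :: real
    have "(?f has_real_derivative (z - 1 + exp (- z))) (at z)"
      by (auto intro!: derivative_eq_intros)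
    moreover have "z - 1 + exp (- z) \<ge> 0"
      using exp_ge_add_one_self[of "- z"] by linarith
    ultimately show "\<exists>y. (?f has_real_derivative y) (at z) \<and> 0 \<le> y" by blast
  qed
  then show ?thesis by simp
qed

text \<open>The loss estimate of expert \<open>i\<close> is \<open>1 / vote_mass I w g a\<close> if
  \<open>a\<close> was wrong and recommended by \<open>i\<close>, and \<open>0\<close> otherwise.
  The feedback bit suffices to compute it, and its mean is the true loss
  \<open>of_bool (g i \<noteq> y)\<close>.\<close>

definition exp4_update ::
    "real \<Rightarrow> 'i set \<Rightarrow> ('i \<Rightarrow> 'y) \<Rightarrow> 'y \<Rightarrow> bool \<Rightarrow> ('i \<Rightarrow> real) \<Rightarrow> 'i \<Rightarrow> real" where
  "exp4_update \<eta> I g a b w i =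
     (if b \<and> g i = a then w i * exp (- \<eta> / vote_mass I w g a) else w i)"

lemma exp4_update_pos: "w i > 0 \<Longrightarrow> exp4_update \<eta> I g a b w i > 0"
  by (simp add: exp4_update_def)

text \<open>
  The expected one-round change of the potential \<open>(ln (\<Sum>j. w j) - ln (w i)) / \<eta>\<close>. Since
  \<open>e\<^sup>-\<^sup>x \<le> 1 - x + x\<^sup>2 / 2\<close>, an importance-weighted loss \<open>1 / p a\<close> costs a second-order term
  \<open>\<eta> / (2 * p a)\<close>, which is incurred with probability \<open>p a\<close>: each label of
  positive mass contributes at most \<open>\<eta> / 2\<close>, however small its probability.
\<close>

lemma exp4_step:
  fixes w :: "'i \<Rightarrow> real" and g :: "'i \<Rightarrow> 'y" and y :: 'y
  assumes I: "finite I" "i \<in> I" and w: "\<And>i. i \<in> I \<Longrightarrow> w i > 0" and \<eta>: "\<eta> > 0"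
  defines "w' \<equiv> \<lambda>a. exp4_update \<eta> I g a (a \<noteq> y) w"
  shows "(\<Sum>a\<in>g ` I. vote_mass I w g a *
            (of_bool (a \<noteq> y) + (ln (sum (w' a) I) - ln (w' a i)) / \<eta>))
         \<le> of_bool (g i \<noteq> y) + (ln (sum w I) - ln (w i)) / \<eta> + \<eta> / 2 * card (g ` I)"
proof -
  define W where "W = sum w I"
  define p where "p = vote_mass I w g"
  have W: "W > 0" unfolding W_def using I w by (intro sum_pos) auto
  have p_pos: "p a > 0" if "a \<in> g ` I" for a
    using that I W w unfolding p_def vote_mass_def W_def[symmetric]
    by (intro divide_pos_pos sum_pos) auto
  have p_sum: "(\<Sum>a\<in>g ` I. p a) = 1"
    using sum.image_gen[of I w g] I W
    by (simp add: p_def vote_mass_def W_def[symmetric] sum_divide_distrib[symmetric])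
  \<comment> \<open>A wrong \<open>a\<close> scales the share \<open>p a\<close> of the total weight
    by \<open>exp (- \<eta> / p a)\<close>. The bounds \<open>ln u \<le> u - 1\<close> and
    \<open>exp_minus_le_quadratic\<close> then control the change of the logarithm.\<close>
  have log_potential: "p a * ((ln (sum (w' a) I) - ln W) / \<eta>) \<le> of_bool (a \<noteq> y) * (- p a + \<eta> / 2)"
    if a: "a \<in> g ` I" for a
  proof (cases "a = y")
    case True
    then show ?thesis by (simp add: w'_def exp4_update_def W_def[symmetric])
  next
    case False
    have "sum (w' a) I = sum (w' a) {i \<in> I. g i = a} + sum (w' a) {i \<in> I. g i \<noteq> a}"
      using I by (subst sum.union_disjoint[symmetric]) (auto intro!: sum.cong)
    also have "\<dots> = sum w {i \<in> I. g i = a} * exp (- \<eta> / p a) + sum w {i \<in> I. g i \<noteq> a}"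
      using False by (simp add: w'_def exp4_update_def sum_distrib_right p_def)
    also have "sum w {i \<in> I. g i \<noteq> a} = W - sum w {i \<in> I. g i = a}"
    proof -
      have "W = sum w {i \<in> I. g i = a} + sum w {i \<in> I. g i \<noteq> a}"
        unfolding W_def using I by (subst sum.union_disjoint[symmetric]) (auto intro!: sum.cong)
      then show ?thesis by simp
    qed
    also have "sum w {i \<in> I. g i = a} = p a * W"
      using W by (simp add: p_def vote_mass_def W_def)
    finally have W': "sum (w' a) I = W * (1 - p a * (1 - exp (- \<eta> / p a)))"
      by (simp add: algebra_simps)
    have pos: "sum (w' a) I > 0"
      unfolding w'_def using I w by (intro sum_pos exp4_update_pos) auto
    then have pos': "1 - p a * (1 - exp (- \<eta> / p a)) > 0"
      using W W' by (simp add: zero_less_mult_iff)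
    have "exp (- \<eta> / p a) \<le> 1 - \<eta> / p a + (\<eta> / p a)\<^sup>2 / 2"
      using exp_minus_le_quadratic[of "\<eta> / p a"] \<eta> p_pos[OF a] by simp
    then have "p a * (1 - exp (- \<eta> / p a)) \<ge> p a * (\<eta> / p a - (\<eta> / p a)\<^sup>2 / 2)"
      using p_pos[OF a] by (intro mult_left_mono) auto
    also have "p a * (\<eta> / p a - (\<eta> / p a)\<^sup>2 / 2) = \<eta> - \<eta>\<^sup>2 / (2 * p a)"
      using p_pos[OF a] by (simp add: field_simps power2_eq_square)
    finally have ge: "p a * (1 - exp (- \<eta> / p a)) \<ge> \<eta> - \<eta>\<^sup>2 / (2 * p a)" .
    have "ln (sum (w' a) I) - ln W = ln (1 - p a * (1 - exp (- \<eta> / p a)))"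
      unfolding W' using W pos' by (simp add: ln_mult)
    also have "\<dots> \<le> - (p a * (1 - exp (- \<eta> / p a)))"
      using ln_le_minus_one[OF pos'] by simp
    also have "\<dots> \<le> - \<eta> + \<eta>\<^sup>2 / (2 * p a)" using ge by simp
    finally have "p a * ((ln (sum (w' a) I) - ln W) / \<eta>) \<le> p a * ((- \<eta> + \<eta>\<^sup>2 / (2 * p a)) / \<eta>)"
      using \<eta> p_pos[OF a] by (intro mult_left_mono divide_right_mono) auto
    also have "\<dots> = - p a + \<eta> / 2"
      using \<eta> p_pos[OF a] by (simp add: field_simps power2_eq_square)
    finally show ?thesis using False by simp
  qed
  \<comment> \<open>Unbiasedness of the estimate: the drop \<open>\<eta> / p a\<close> occurs only
    for \<open>a = g i\<close>, and the factor \<open>p a\<close> cancels it to the true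
    loss.\<close>
  have log_expert: "p a * ((ln (w i) - ln (w' a i)) / \<eta>) = (if a = g i then of_bool (a \<noteq> y) else 0)"
    if a: "a \<in> g ` I" for a
    using \<eta> p_pos[OF a] w[OF I(2)]
    by (auto simp: w'_def exp4_update_def ln_mult p_def)
  \<comment> \<open>The new potential is split into the change of the total weight, the change of
    the weight of \<open>i\<close>, and the old potential.\<close>
  have "(\<Sum>a\<in>g ` I. p a * (of_bool (a \<noteq> y) + (ln (sum (w' a) I) - ln (w' a i)) / \<eta>))
      = (\<Sum>a\<in>g ` I. p a * of_bool (a \<noteq> y) + p a * ((ln (sum (w' a) I) - ln W) / \<eta>)
           + p a * ((ln (w i) - ln (w' a i)) / \<eta>) + p a * ((ln W - ln (w i)) / \<eta>))"
    by (intro sum.cong) (auto simp: algebra_simps add_divide_distrib diff_divide_distrib)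
  also have "\<dots> \<le> (\<Sum>a\<in>g ` I. \<eta> / 2 + (if a = g i then of_bool (a \<noteq> y) else 0)
           + p a * ((ln W - ln (w i)) / \<eta>))"
  proof (intro sum_mono)
    fix a assume a: "a \<in> g ` I"
    \<comment> \<open>The learner's own expected loss cancels against the first-order decrease of
      the total weight.\<close>
    have "p a * of_bool (a \<noteq> y) + of_bool (a \<noteq> y) * (- p a + \<eta> / 2) \<le> \<eta> / 2"
      using \<eta> by auto
    then show "p a * of_bool (a \<noteq> y) + p a * ((ln (sum (w' a) I) - ln W) / \<eta>)
           + p a * ((ln (w i) - ln (w' a i)) / \<eta>) + p a * ((ln W - ln (w i)) / \<eta>)
         \<le> \<eta> / 2 + (if a = g i then of_bool (a \<noteq> y) else 0) + p a * ((ln W - ln (w i)) / \<eta>)"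
      using log_potential[OF a] log_expert[OF a] by linarith
  qed
  also have "\<dots> = \<eta> / 2 * card (g ` I) + of_bool (g i \<noteq> y)
      + (\<Sum>a\<in>g ` I. p a) * ((ln W - ln (w i)) / \<eta>)"
    unfolding sum_distrib_right using I by (simp add: sum.distrib)
  finally show ?thesis unfolding p_sum by (simp add: p_def W_def algebra_simps)
qed

section \<open>The EXP4 learner and its mistake bound\<close>

definition exp4_step_state ::
    "real \<Rightarrow> 'i set \<Rightarrow> ('i \<Rightarrow> 'x list \<Rightarrow> 'y) \<Rightarrow> 'x list \<times> ('i \<Rightarrow> real) \<Rightarrow> 'x \<times> 'y \<times> bool
      \<Rightarrow> 'x list \<times> ('i \<Rightarrow> real)" where
  "exp4_step_state \<eta> I f = (\<lambda>(xs, w) (x, a, b).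
     (xs @ [x], exp4_update \<eta> I (\<lambda>i. f i (xs @ [x])) a b w))"

text \<open>A learner is a function of the history, so its state is recomputed from there. The
  instances are kept because an expert's advice depends on all of them, the current one
  last.\<close>

definition exp4_state ::
    "real \<Rightarrow> 'i set \<Rightarrow> ('i \<Rightarrow> 'x list \<Rightarrow> 'y) \<Rightarrow> ('x, 'y) history \<Rightarrow> 'x list \<times> ('i \<Rightarrow> real)" where
  "exp4_state \<eta> I f = foldl (exp4_step_state \<eta> I f) ([], \<lambda>_. 1)"

definition exp4 ::
    "real \<Rightarrow> 'i set \<Rightarrow> ('i \<Rightarrow> 'x list \<Rightarrow> 'y) \<Rightarrow> ('x, 'y) bandit_learner" where
  "exp4 \<eta> I f hist x =
     (case exp4_state \<eta> I f hist of (xs, w) \<Rightarrow> map_pmf (\<lambda>i. f i (xs @ [x])) (expert_pmf I w))"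

primrec expert_loss :: "('x list \<Rightarrow> 'y) \<Rightarrow> 'x list \<Rightarrow> ('x \<times> 'y) list \<Rightarrow> nat" where
  "expert_loss g xs [] = 0"
| "expert_loss g xs (z # zs) =
     of_bool (g (xs @ [fst z]) \<noteq> snd z) + expert_loss g (xs @ [fst z]) zs"

lemma mistakes_snoc: "mistakes (hist @ [(x, a, b)]) = mistakes hist + of_bool b"
  by (simp add: mistakes_def)

lemma mistakes_le_length: "hist \<in> set_pmf (play A hist0 zs) \<Longrightarrow> mistakes hist \<le> mistakes hist0 + length zs"
proof (induction zs arbitrary: hist0)
  case (Cons z zs)
  then obtain a where
    "hist \<in> set_pmf (play A (hist0 @ [(fst z, a, a \<noteq> snd z)]) zs)" by auto
  from Cons.IH[OF this] show ?case
    by (simp add: mistakes_snoc of_bool_def split: if_splits)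
qed simp

lemma expected_mistakes_le_length: "expected_mistakes A zs \<le> length zs"
proof -
  have *: "mistakes hist \<le> length zs" if "hist \<in> set_pmf (play A [] zs)" for hist
    using mistakes_le_length[OF that] by (simp add: mistakes_def)
  have "expected_mistakes A zs \<le> measure_pmf.expectation (play A [] zs) (\<lambda>_. real (length zs))"
    unfolding expected_mistakes_def using *
    by (intro integral_mono_AE measure_pmf.integrable_const_bound[where B = "length zs"])
       (auto simp: AE_measure_pmf_iff)
  then show ?thesis by simp
qed

text \<open>Makes every expectation over plays a finite sum, as \<open>pmf_expectation_bind\<close>
  requires.\<close>

lemma finite_set_play:
  assumes "\<And>hist x. finite (set_pmf (A hist x))"
  shows "finite (set_pmf (play A hist zs))"
  using assms by (induction zs arbitrary: hist) auto

lemma exp4_state_weights_pos: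
  "exp4_state \<eta> I f hist = (xs, w) \<Longrightarrow> w i > 0"
proof (induction hist arbitrary: xs w rule: rev_induct)
  case (snoc z hist)
  obtain xs' w' where s: "exp4_state \<eta> I f hist = (xs', w')" by fastforce
  with snoc.IH have "w' i > 0" by blast
  with s snoc.prems show ?case
    by (cases z) (auto simp: exp4_state_def exp4_step_state_def exp4_update_pos)
qed (auto simp: exp4_state_def)

text \<open>Induction over the remaining rounds from an arbitrary history: the potential pays for
  the past, and \<open>exp4_step\<close>, averaged over the next prediction, pays for one more
  round.\<close>

lemma exp4_potential:
  fixes f :: "'i \<Rightarrow> 'x list \<Rightarrow> 'y"
  assumes I: "finite I" "i \<in> I" and \<eta>: "\<eta> > 0"
    and K: "\<And>xs x. card ((\<lambda>i. f i (xs @ [x])) ` I) \<le> K"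
    and "exp4_state \<eta> I f hist = (xs, w)"
  shows "measure_pmf.expectation (play (exp4 \<eta> I f) hist zs) (\<lambda>hist. real (mistakes hist))
     \<le> mistakes hist + expert_loss (f i) xs zs + (ln (sum w I) - ln (w i)) / \<eta>
        + \<eta> / 2 * K * length zs"
  using assms(5)
proof (induction zs arbitrary: hist xs w)
  case Nil
  have w: "w j > 0" for j using exp4_state_weights_pos[OF Nil] .
  have "w i \<le> sum w I" using I w by (intro member_le_sum) (auto simp: less_imp_le)
  then have "0 \<le> (ln (sum w I) - ln (w i)) / \<eta>" using w[of i] \<eta> by simp
  then show ?case by simp
next
  case (Cons z zs)
  obtain x y where z: "z = (x, y)" by fastforce
  have w: "w j > 0" for j using exp4_state_weights_pos[OF Cons.prems] .
  define g where "g = (\<lambda>i. f i (xs @ [x]))"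
  define w' where "w' = (\<lambda>a. exp4_update \<eta> I g a (a \<noteq> y) w)"
  \<comment> \<open>\<open>c\<close> collects what does not depend on the sampled label; the rest
    matches the left side of \<open>exp4_step\<close>.\<close>
  define c where "c = mistakes hist + expert_loss (f i) (xs @ [x]) zs + \<eta> / 2 * K * length zs"
  let ?E = "\<lambda>hist. measure_pmf.expectation (play (exp4 \<eta> I f) hist zs) (\<lambda>hist. real (mistakes hist))"
  have I_ne: "I \<noteq> {}" using I by auto
  have A: "exp4 \<eta> I f hist x = map_pmf g (expert_pmf I w)"
    by (simp add: exp4_def Cons.prems g_def)
  have pmf_A: "pmf (exp4 \<eta> I f hist x) a = vote_mass I w g a" for a
    unfolding A using I I_ne w by (intro pmf_map_expert_pmf) auto
  have fin: "finite (set_pmf (exp4 \<eta> I f hist' x'))" for hist' x'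
  proof -
    obtain xs'' w'' where s: "exp4_state \<eta> I f hist' = (xs'', w'')" by fastforce
    have "set_pmf (expert_pmf I w'') \<subseteq> I"
      using I I_ne exp4_state_weights_pos[OF s] by (intro set_expert_pmf) auto
    then have "finite (set_pmf (expert_pmf I w''))" using I finite_subset by blast
    then show ?thesis by (simp add: exp4_def s)
  qed
  have fin_play: "finite (set_pmf (play (exp4 \<eta> I f) hist' zs))" for hist'
    using fin by (rule finite_set_play)
  have "measure_pmf.expectation (play (exp4 \<eta> I f) hist (z # zs)) (\<lambda>hist. real (mistakes hist))
      = (\<Sum>a\<in>g ` I. vote_mass I w g a * ?E (hist @ [(x, a, a \<noteq> y)]))"
    unfolding play.simps
    using I set_expert_pmf[of I w, OF I(1) I_ne w] fin_play
    by (subst pmf_expectation_bind[where A = "g ` I"]) (auto simp: z pmf_A, auto simp: A)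
  also have "\<dots> \<le> (\<Sum>a\<in>g ` I. vote_mass I w g a *
      (c + (of_bool (a \<noteq> y) + (ln (sum (w' a) I) - ln (w' a i)) / \<eta>)))"
  proof (intro sum_mono mult_left_mono)
    fix a assume a: "a \<in> g ` I"
    have "exp4_state \<eta> I f (hist @ [(x, a, a \<noteq> y)]) = (xs @ [x], w' a)"
      using Cons.prems by (simp add: exp4_state_def exp4_step_state_def w'_def g_def)
    from Cons.IH[OF this]
    show "?E (hist @ [(x, a, a \<noteq> y)])
        \<le> c + (of_bool (a \<noteq> y) + (ln (sum (w' a) I) - ln (w' a i)) / \<eta>)"
      by (simp add: mistakes_snoc c_def)
    show "0 \<le> vote_mass I w g a" using pmf_A[of a] pmf_nonneg by metis
  qed
  also have "\<dots> = c * (\<Sum>a\<in>g ` I. vote_mass I w g a) + (\<Sum>a\<in>g ` I. vote_mass I w g a *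
      (of_bool (a \<noteq> y) + (ln (sum (w' a) I) - ln (w' a i)) / \<eta>))"
    by (simp add: distrib_left sum.distrib sum_distrib_left mult.commute)
  also have "(\<Sum>a\<in>g ` I. vote_mass I w g a) = 1"
  proof -
    have "set_pmf (exp4 \<eta> I f hist x) \<subseteq> g ` I"
      using set_expert_pmf[of I w, OF I(1) I_ne w] by (auto simp: A)
    then show ?thesis using I by (simp add: pmf_A[symmetric] sum_pmf_eq_1)
  qed
  also have "c * 1 + (\<Sum>a\<in>g ` I. vote_mass I w g a *
      (of_bool (a \<noteq> y) + (ln (sum (w' a) I) - ln (w' a i)) / \<eta>))
    \<le> c + (of_bool (g i \<noteq> y) + (ln (sum w I) - ln (w i)) / \<eta> + \<eta> / 2 * card (g ` I))"
    unfolding w'_def using exp4_step[of I i w \<eta> g y] I w \<eta> by simp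
  also have "\<dots> \<le> c + (of_bool (g i \<noteq> y) + (ln (sum w I) - ln (w i)) / \<eta> + \<eta> / 2 * K)"
    using K[of xs x] \<eta> by (simp add: g_def)
  finally show ?case by (simp add: c_def z g_def algebra_simps add_divide_distrib)
qed

text \<open>All weights start at \<open>1\<close>, so the initial potential is
  \<open>ln (card I) / \<eta>\<close>.\<close>

lemma exp4_mistakes:
  fixes f :: "'i \<Rightarrow> 'x list \<Rightarrow> 'y"
  assumes "finite I" "i \<in> I" "\<eta> > 0"
    and "\<And>xs x. card ((\<lambda>i. f i (xs @ [x])) ` I) \<le> K"
  shows "expected_mistakes (exp4 \<eta> I f) zs
     \<le> expert_loss (f i) [] zs + ln (card I) / \<eta> + \<eta> / 2 * K * length zs"
  using exp4_potential[of I i \<eta> f K "[]" "[]" "\<lambda>_. 1" zs] assms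
  by (simp add: expected_mistakes_def exp4_state_def mistakes_def)


subsection \<open>Experts from the standard optimal algorithm\<close>

abbreviation shatters :: "('x \<Rightarrow> 'y) set \<Rightarrow> nat \<Rightarrow> bool" where
  "shatters V d \<equiv> \<exists>tr lab. littlestone_shattered V d tr lab"

lemma shatters_0_iff: "shatters V 0 \<longleftrightarrow> V \<noteq> {}"
  by (auto simp: littlestone_shattered_def)

text \<open>The two trees are joined below a new root \<open>x\<close> whose edges carry
  \<open>y\<close> and \<open>y'\<close>.\<close>

lemma shatters_Suc:
  assumes "shatters {h \<in> V. h x = y} d" "shatters {h \<in> V. h x = y'} d" "y \<noteq> y'"
  shows "shatters V (Suc d)"
proof -
  obtain tr1 lab1 where 1: "littlestone_shattered {h \<in> V. h x = y} d tr1 lab1"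
    using assms(1) by blast
  obtain tr2 lab2 where 2: "littlestone_shattered {h \<in> V. h x = y'} d tr2 lab2"
    using assms(2) by blast
  define tr where "tr p = (case p of [] \<Rightarrow> x | b # q \<Rightarrow> if b then tr1 q else tr2 q)" for p
  define lab where "lab p = (case p of [] \<Rightarrow> y | b # q \<Rightarrow>
      if q = [] then (if b then y else y') else if b then lab1 q else lab2 q)" for p
  have "littlestone_shattered V (Suc d) tr lab"
    unfolding littlestone_shattered_def
  proof (intro conjI allI impI)
    fix p :: "bool list" assume "length p < Suc d"
    then show "lab (p @ [True]) \<noteq> lab (p @ [False])"
      using 1 2 assms(3) by (cases p) (auto simp: lab_def littlestone_shattered_def)
  next
    fix \<sigma> :: "bool list" assume "length \<sigma> = Suc d"
    then obtain b q where \<sigma>: "\<sigma> = b # q" and q: "length q = d" by (cases \<sigma>) auto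
    obtain h where h: "h \<in> V" "h x = (if b then y else y')"
      "\<forall>t<d. h ((if b then tr1 else tr2) (take t q)) = (if b then lab1 else lab2) (take (Suc t) q)"
      using 1 2 q unfolding littlestone_shattered_def by (cases b) auto
    have "h (tr (take t \<sigma>)) = lab (take (Suc t) \<sigma>)" if "t < Suc d" for t
    proof (cases t)
      case 0
      then show ?thesis using h(2) by (simp add: tr_def lab_def \<sigma>)
    next
      case (Suc s)
      then have "s < d" using that by simp
      \<comment> \<open>Selects the branch of \<open>lab\<close> below the root edge, which is the
        case \<open>q = []\<close> of its definition.\<close>
      moreover have "take (Suc s) q \<noteq> []" using \<open>s < d\<close> q by auto
      ultimately show ?thesis using h(3) Suc by (cases b) (auto simp: tr_def lab_def \<sigma>)
    qed
    with h(1) show "\<exists>h\<in>V. \<forall>t<Suc d. h (tr (take t \<sigma>)) = lab (take (Suc t) \<sigma>)" by blast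
  qed
  then show ?thesis by blast
qed

text \<open>\<open>d\<close> is a budget bounding the Littlestone dimension of \<open>V\<close>.
  Restricting the choice to values of \<open>H\<close> at \<open>x\<close> keeps the number of
  predictions bounded.\<close>

definition soa :: "('x \<Rightarrow> 'y) set \<Rightarrow> nat \<Rightarrow> ('x \<Rightarrow> 'y) set \<Rightarrow> 'x \<Rightarrow> 'y" where
  "soa H d V x = (SOME y. y \<in> (\<lambda>h. h x) ` H \<and>
     (\<not> shatters V (Suc d) \<longrightarrow> (\<forall>y'. y' \<noteq> y \<longrightarrow> \<not> shatters {h \<in> V. h x = y'} d)))"

lemma shatters_imp_nonempty: "shatters V d \<Longrightarrow> V \<noteq> {}"
  unfolding littlestone_shattered_def by (metis Ex_list_of_length empty_iff)

text \<open>By \<open>shatters_Suc\<close>, two different labels cannot both leave a subclass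
  shattering depth \<open>d\<close> unless \<open>V\<close> shatters \<open>Suc d\<close>. Hence
  each error lowers the budget by one.\<close>

lemma soa:
  assumes "V \<subseteq> H" "H \<noteq> {}"
  shows "soa H d V x \<in> (\<lambda>h. h x) ` H"
    and "\<not> shatters V (Suc d) \<Longrightarrow> y' \<noteq> soa H d V x \<Longrightarrow> \<not> shatters {h \<in> V. h x = y'} d"
proof -
  have "\<exists>y. y \<in> (\<lambda>h. h x) ` H \<and>
     (\<not> shatters V (Suc d) \<longrightarrow> (\<forall>y'. y' \<noteq> y \<longrightarrow> \<not> shatters {h \<in> V. h x = y'} d))"
  proof (cases "\<exists>y. shatters {h \<in> V. h x = y} d")
    case True
    then obtain y where y: "shatters {h \<in> V. h x = y} d" by blast
    have "y \<in> (\<lambda>h. h x) ` H" using shatters_imp_nonempty[OF y] assms(1) by blast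
    moreover have "\<forall>y'. y' \<noteq> y \<longrightarrow> \<not> shatters {h \<in> V. h x = y'} d" if "\<not> shatters V (Suc d)"
      using shatters_Suc[OF y] that by metis
    ultimately show ?thesis by blast
  next
    case False
    then show ?thesis using assms(2) by (auto simp del: ex_simps)
  qed
  from someI_ex[OF this] show "soa H d V x \<in> (\<lambda>h. h x) ` H"
    and "\<not> shatters V (Suc d) \<Longrightarrow> y' \<noteq> soa H d V x \<Longrightarrow> \<not> shatters {h \<in> V. h x = y'} d"
    unfolding soa_def[symmetric] by blast+
qed

text \<open>
  An entry \<open>Some j\<close> of the code marks a round on which the simulated standard optimal algorithm
  errs, \<open>j\<close> being the index of the correct label; the version space is only updated then.
\<close>

fun soa_expert ::
    "('x \<Rightarrow> 'y) set \<Rightarrow> ('x \<Rightarrow> nat \<Rightarrow> 'y) \<Rightarrow> nat \<Rightarrow> ('x \<Rightarrow> 'y) set \<Rightarrow> nat option list \<Rightarrow> 'x list \<Rightarrow> 'y"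
where
  "soa_expert H lab d V (None # cs) (x # xs) =
     (if xs = [] then soa H d V x else soa_expert H lab d V cs xs)"
| "soa_expert H lab d V (Some j # cs) (x # xs) =
     (if xs = [] then lab x j else soa_expert H lab (d - 1) {h \<in> V. h x = lab x j} cs xs)"
| "soa_expert H lab d V [] xs = lab (last xs) 0"
| "soa_expert H lab d V (c # cs) [] = undefined"

text \<open>The default for an exhausted code is also a value of \<open>H\<close>, so the label
  count holds for instance lists of any length, as the card bound in \<open>exp4_mistakes\<close>
  demands.\<close>

lemma soa_expert_in_labels:
  assumes "\<And>x j. lab x j \<in> (\<lambda>h. h x) ` H" "V \<subseteq> H" "H \<noteq> {}" "xs \<noteq> []"
  shows "soa_expert H lab d V cs xs \<in> (\<lambda>h. h (last xs)) ` H"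
  using assms
proof (induction H lab d V cs xs rule: soa_expert.induct)
  case (1 H lab d V cs x xs)
  then show ?case using soa(1)[of V H d x] by auto
next
  case (2 H lab d V j cs x xs)
  then show ?case by auto
qed auto

section \<open>Counting the patterns of mistakes\<close>

fun mistake_codes :: "nat \<Rightarrow> nat \<Rightarrow> nat \<Rightarrow> nat option list set" where
  "mistake_codes K d 0 = {[]}"
| "mistake_codes K 0 (Suc n) = (#) None ` mistake_codes K 0 n"
| "mistake_codes K (Suc d) (Suc n) = (#) None ` mistake_codes K (Suc d) n
     \<union> (\<Union>j<K. (#) (Some j) ` mistake_codes K d n)"

lemma finite_mistake_codes: "finite (mistake_codes K d n)"
  by (induction K d n rule: mistake_codes.induct) auto

text \<open>The codes are the lists of length \<open>n\<close> with at most \<open>d\<close> entries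
  \<open>Some j\<close>, \<open>j < K\<close>. Each of the \<open>d\<close> possible mistakes has a
  label index and either one of \<open>n\<close> rounds or no round at all.\<close>

lemma card_mistake_codes:
  assumes "K \<ge> 1"
  shows "card (mistake_codes K d n) \<le> ((n + 1) * K) ^ d"
  using assms
proof (induction K d n rule: mistake_codes.induct)
  case (1 K d)
  then show ?case by simp
next
  case (2 K n)
  then show ?case using card_image_le[OF finite_mistake_codes, of "(#) None" K 0 n] by simp
next
  case (3 K d n)
  let ?N = "((n + 1) * K) ^ d"
  have "card (mistake_codes K (Suc d) (Suc n))
      \<le> card ((#) None ` mistake_codes K (Suc d) n)
        + card (\<Union>j<K. (#) (Some j) ` mistake_codes K d n)"
    by (simp add: card_Un_le)
  also have "\<dots> \<le> card (mistake_codes K (Suc d) n) + (\<Sum>j<K. card (mistake_codes K d n))"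
    by (intro add_mono card_image_le finite_mistake_codes
        order_trans[OF card_UN_le] sum_mono) auto
  also have "\<dots> \<le> ((n + 1) * K) ^ Suc d + (\<Sum>j<K. ?N)"
    using 3 by (intro add_mono sum_mono) auto
  also have "\<dots> = ?N * ((n + 2) * K)" by (simp add: algebra_simps)
  also have "\<dots> \<le> ((n + 2) * K) ^ d * ((n + 2) * K)"
    by (intro mult_right_mono power_mono) auto
  finally show ?case by (simp add: mult.commute)
qed

text \<open>The code is built along \<open>xs\<close>: \<open>None\<close> while the algorithm
  agrees with \<open>h\<close>, and otherwise the index of \<open>h x\<close>. The restricted
  version space still contains \<open>h\<close>, and its budget is one less.\<close>

lemma soa_expert_covers:
  assumes lab: "\<And>x. (\<lambda>h. h x) ` H \<subseteq> lab x ` {..<K}"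
    and "V \<subseteq> H" "h \<in> V" "\<not> shatters V (Suc d)"
  shows "\<exists>c \<in> mistake_codes K d (length xs).
    \<forall>t < length xs. soa_expert H lab d V c (take (Suc t) xs) = h (xs ! t)"
  using assms(2-)
proof (induction xs arbitrary: d V)
  case Nil
  then show ?case by simp
next
  case (Cons x xs)
  have H: "H \<noteq> {}" using Cons.prems by auto
  show ?case
  proof (cases "h x = soa H d V x")
    case True
    obtain c where c: "c \<in> mistake_codes K d (length xs)"
      "\<And>t. t < length xs \<Longrightarrow> soa_expert H lab d V c (take (Suc t) xs) = h (xs ! t)"
      using Cons.IH[OF Cons.prems] by blast
    have "None # c \<in> mistake_codes K d (length (x # xs))"
      using c(1) by (cases d) auto
    moreover have "soa_expert H lab d V (None # c) (take (Suc t) (x # xs)) = h ((x # xs) ! t)"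
      if "t < length (x # xs)" for t
      using that c(2) True by (cases t) auto
    ultimately show ?thesis by blast
  next
    case False
    let ?V = "{g \<in> V. g x = h x}"
    have ns: "\<not> shatters ?V d" using soa(2)[OF Cons.prems(1) H Cons.prems(3) False] .
    have "h \<in> ?V" using Cons.prems by simp
    \<comment> \<open>No error can occur at budget \<open>0\<close>: a version space containing
      \<open>h\<close> shatters depth \<open>0\<close>.\<close>
    then obtain d' where d: "d = Suc d'" using ns shatters_0_iff[of ?V] by (cases d) auto
    obtain c where c: "c \<in> mistake_codes K d' (length xs)"
      "\<And>t. t < length xs \<Longrightarrow> soa_expert H lab d' ?V c (take (Suc t) xs) = h (xs ! t)"
      using Cons.IH[of ?V d'] Cons.prems ns d by fastforce
    obtain j where j: "j < K" "lab x j = h x"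
      using lab[of x] Cons.prems by (metis image_eqI image_iff lessThan_iff subsetD)
    have "Some j # c \<in> mistake_codes K d (length (x # xs))" using c(1) j d by auto
    moreover have "soa_expert H lab d V (Some j # c) (take (Suc t) (x # xs)) = h ((x # xs) ! t)"
      if "t < length (x # xs)" for t
      using that c(2) j d by (cases t) auto
    ultimately show ?thesis by blast
  qed
qed

section \<open>Consequences of bounded dimensions\<close>

lemma littlestone_dim_ge: "shatters H d \<Longrightarrow> enat d \<le> littlestone_dim H"
  unfolding littlestone_dim_def by (intro Sup_upper) blast

lemma bandit_littlestone_dim_ge: "bandit_shattered H d tr \<Longrightarrow> enat d \<le> bandit_littlestone_dim H"
  unfolding bandit_littlestone_dim_def by (intro Sup_upper) blast

lemma card_labels_le:
  assumes "bandit_littlestone_dim H = enat B"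
  shows "finite ((\<lambda>h. h x) ` H)" "card ((\<lambda>h. h x) ` H) \<le> B + 1"
proof -
  have *: "finite ((\<lambda>h. h x) ` H) \<and> card ((\<lambda>h. h x) ` H) \<le> B + 1"
  proof (rule ccontr)
    assume neg: "\<not> ?thesis"
    have "bandit_shattered H (Suc B) (\<lambda>_. x)"
      unfolding bandit_shattered_def
    proof (intro allI impI)
      fix ys :: "'b list" assume len: "length ys = Suc B"
      \<comment> \<open>A path of \<open>Suc B\<close> edges names at most \<open>Suc B\<close>
        labels, so some value at \<open>x\<close> escapes all of them.\<close>
      have "\<not> (\<lambda>h. h x) ` H \<subseteq> set ys"
      proof
        assume sub: "(\<lambda>h. h x) ` H \<subseteq> set ys"
        from neg finite_subset[OF sub] card_mono[OF _ sub] card_length[of ys] len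
        show False by auto
      qed
      then obtain h where "h \<in> H" "h x \<notin> set ys" by blast
      then show "\<exists>h\<in>H. \<forall>t<Suc B. h x \<noteq> ys ! t" using len by (metis nth_mem)
    qed
    then have "enat (Suc B) \<le> bandit_littlestone_dim H" by (rule bandit_littlestone_dim_ge)
    with assms show False by simp
  qed
  from * show "finite ((\<lambda>h. h x) ` H)" "card ((\<lambda>h. h x) ` H) \<le> B + 1" by auto
qed


subsection \<open>The regret bound\<close>

text \<open>Depth-one trees at \<open>x\<close> suffice: any label is missed by \<open>h\<close> or
  \<open>h'\<close>. This rules out a product of \<open>0\<close> and infinity in the bound and
  allows \<open>B + 1 \<le> 2 * B\<close>.\<close>

lemma dims_ge_1:
  assumes "h \<in> H" "h' \<in> H" "h x \<noteq> h' x"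
  shows "littlestone_dim H \<ge> 1" "bandit_littlestone_dim H \<ge> 1"
proof -
  have "shatters {g \<in> H. g x = h x} 0" "shatters {g \<in> H. g x = h' x} 0"
    unfolding shatters_0_iff using assms by blast+
  from shatters_Suc[OF this assms(3)] have "enat (Suc 0) \<le> littlestone_dim H"
    by (rule littlestone_dim_ge)
  then show "littlestone_dim H \<ge> 1" by (simp add: one_enat_def)
  have "\<exists>g\<in>H. g x \<noteq> y" for y using assms by metis
  then have "bandit_shattered H 1 (\<lambda>_. x)" by (simp add: bandit_shattered_def)
  then show "bandit_littlestone_dim H \<ge> 1"
    using bandit_littlestone_dim_ge by (fastforce simp: one_enat_def)
qed

lemma ereal_sqrt_nonneg: "a \<ge> 0 \<Longrightarrow> ereal_sqrt a \<ge> 0"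
  by (cases a) (auto simp: ereal_sqrt_def)

lemma expected_regret_leI:
  fixes c :: real
  assumes "\<And>zs h. length zs = T \<Longrightarrow> h \<in> H \<Longrightarrow> expected_mistakes A zs \<le> hyp_loss h zs + c"
  shows "expected_regret A T H \<le> ereal c"
  unfolding expected_regret_def
proof (intro SUP_least)
  fix zs :: "('a \<times> 'b) list" assume "zs \<in> {zs. length zs = T}"
  then have "ereal (expected_mistakes A zs - c) \<le> (INF h\<in>H. ereal (real (hyp_loss h zs)))"
    using assms[of zs] by (intro INF_greatest) (simp add: algebra_simps)
  then show "ereal (expected_mistakes A zs) - (INF h\<in>H. ereal (real (hyp_loss h zs))) \<le> ereal c"
    \<comment> \<open>For empty \<open>H\<close> the infimum is infinite and the difference is minus
      infinity.\<close>
    by (cases "INF h\<in>H. ereal (real (hyp_loss h zs))") auto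
qed

lemma expert_loss_eq_hyp_loss:
  assumes "\<And>t. t < length zs \<Longrightarrow> g (xs @ take (Suc t) (map fst zs)) = h (fst (zs ! t))"
  shows "expert_loss g xs zs = hyp_loss h zs"
  using assms
proof (induction zs arbitrary: xs)
  case Nil
  then show ?case by (simp add: hyp_loss_def)
next
  case (Cons z zs)
  have "expert_loss g (xs @ [fst z]) zs = hyp_loss h zs"
    by (rule Cons.IH) (use Cons.prems[of "Suc _"] in auto)
  moreover have "g (xs @ [fst z]) = h (fst z)" using Cons.prems[of 0] by simp
  ultimately show ?case by (cases z) (simp add: hyp_loss_def)
qed

text \<open>Both dimensions of a singleton class are \<open>0\<close>, so the bound leaves no slack:
  the learner has to copy \<open>h\<close>.\<close>

lemma deterministic_regret:
  assumes "H = {h}"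
  shows "expected_regret (\<lambda>hist x. return_pmf (h x)) T H \<le> 0"
proof -
  let ?A = "\<lambda>hist x. return_pmf (h x)"
  have "\<exists>hist'. play ?A hist zs = return_pmf hist' \<and> mistakes hist' = mistakes hist + hyp_loss h zs"
    for hist zs
  proof (induction zs arbitrary: hist)
    case (Cons z zs)
    then show ?case
      using Cons[of "hist @ [(fst z, h (fst z), h (fst z) \<noteq> snd z)]"]
      by (cases z) (auto simp: mistakes_snoc hyp_loss_def bind_return_pmf)
  qed (simp add: hyp_loss_def)
  note play = this
  have "expected_mistakes ?A zs = hyp_loss h zs" for zs
    using play[of "[]" zs] by (auto simp: expected_mistakes_def mistakes_def)
  then show ?thesis using expected_regret_leI[of T H ?A 0] assms by (simp add: zero_ereal_def)
qed

text \<open>Indices beyond \<open>card S\<close> are padded with an element of \<open>S\<close>, so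
  that every index denotes a label in \<open>S\<close>.\<close>

lemma ex_label_enumeration:
  assumes "finite S" "S \<noteq> {}" "card S \<le> K"
  shows "\<exists>f. range f \<subseteq> S \<and> S \<subseteq> f ` {..<K::nat}"
proof -
  obtain g where g: "bij_betw g {..<card S} S"
    using ex_bij_betw_nat_finite[OF assms(1)] by (auto simp: atLeast0LessThan)
  obtain s where s: "s \<in> S" using assms(2) by blast
  let ?f = "\<lambda>j. if j < card S then g j else s"
  have "range ?f \<subseteq> S" using g s by (auto simp: bij_betw_def)
  moreover have "S \<subseteq> ?f ` {..<K}"
  proof
    fix y assume "y \<in> S"
    then obtain j where "j < card S" "g j = y" using g by (force simp: bij_betw_def)
    then show "y \<in> ?f ` {..<K}" using assms(3) by (intro image_eqI[of _ _ j]) auto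
  qed
  ultimately show ?thesis by blast
qed

lemma exp4_soa_regret:
  fixes H :: "('x \<Rightarrow> 'y) set"
  assumes H: "H \<noteq> {}" and L: "littlestone_dim H = enat L"
    and B: "bandit_littlestone_dim H = enat B" and \<eta>: "\<eta> > 0"
  obtains A :: "('x, 'y) bandit_learner" where "expected_regret A T H
    \<le> ereal (real L * ln (real ((T + 1) * (B + 1))) / \<eta> + \<eta> / 2 * real (B + 1) * real T)"
proof -
  let ?K = "B + 1"
  have labels: "finite ((\<lambda>h. h x) ` H)" "card ((\<lambda>h. h x) ` H) \<le> ?K" for x
    using card_labels_le[OF B] by auto
  have "\<forall>x. \<exists>f. range f \<subseteq> (\<lambda>h. h x) ` H \<and> (\<lambda>h. h x) ` H \<subseteq> f ` {..<?K}"
    using labels H by (intro allI ex_label_enumeration) auto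
  then obtain lab where lab: "range (lab x) \<subseteq> (\<lambda>h. h x) ` H" "(\<lambda>h. h x) ` H \<subseteq> lab x ` {..<?K}" for x
    by metis
  have not_shatters: "\<not> shatters H (Suc L)"
    using littlestone_dim_ge[of H "Suc L"] L by auto
  define I where "I = mistake_codes ?K L T"
  define f where "f = soa_expert H lab L H"
  have I_fin: "finite I" by (simp add: I_def finite_mistake_codes)
  have cover: "\<exists>c\<in>I. expert_loss (f c) [] zs = hyp_loss h zs" 
    if zs: "length zs = T" and h: "h \<in> H" for zs h
  proof -
    obtain c where "c \<in> I" "\<And>t. t < length zs \<Longrightarrow> f c (take (Suc t) (map fst zs)) = h (fst (zs ! t))"
      using soa_expert_covers[of H lab ?K H h L "map fst zs"] lab(2) zs h not_shatters
      by (auto simp: I_def f_def)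
    then show ?thesis using expert_loss_eq_hyp_loss[of zs "f c" "[]" h] by auto
  qed
  have I_pos: "card I > 0"
  proof -
    obtain h where "h \<in> H" using H by blast
    \<comment> \<open>Any sequence of length \<open>T\<close> yields a covering code.\<close>
    then have "I \<noteq> {}" using cover[of "replicate T undefined" h] by auto
    then show ?thesis using I_fin by (simp add: card_gt_0_iff)
  qed
  have card_range: "card ((\<lambda>c. f c (xs @ [x])) ` I) \<le> ?K" for xs x
  proof -
    have "f c (xs @ [x]) \<in> (\<lambda>h. h x) ` H" for c
      using soa_expert_in_labels[of lab H H "xs @ [x]" L c] lab(1) H
      by (simp add: f_def image_subset_iff)
    then have "card ((\<lambda>c. f c (xs @ [x])) ` I) \<le> card ((\<lambda>h. h x) ` H)"
      by (intro card_mono labels) auto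
    with labels(2)[of x] show ?thesis by simp
  qed
  have "real (card I) \<le> real (((T + 1) * ?K) ^ L)"
    unfolding I_def by (intro of_nat_mono card_mistake_codes) simp
  also have "\<dots> = real ((T + 1) * ?K) ^ L" by simp
  finally have "ln (card I) \<le> ln (real ((T + 1) * ?K) ^ L)"
    using I_pos by (subst ln_le_cancel_iff) auto
  also have "\<dots> = real L * ln (real ((T + 1) * ?K))" by (subst ln_realpow) auto
  finally have ln_I: "ln (card I) / \<eta> \<le> real L * ln (real ((T + 1) * ?K)) / \<eta>"
    using \<eta> by (simp add: divide_right_mono)
  have "expected_regret (exp4 \<eta> I f) T H
      \<le> ereal (real L * ln (real ((T + 1) * ?K)) / \<eta> + \<eta> / 2 * real ?K * real T)"
  proof (rule expected_regret_leI)
    fix zs :: "('x \<times> 'y) list" and h assume zs: "length zs = T" and "h \<in> H"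
    then obtain c where c: "c \<in> I" "expert_loss (f c) [] zs = hyp_loss h zs" using cover by blast
    show "expected_mistakes (exp4 \<eta> I f) zs
        \<le> hyp_loss h zs + (real L * ln (real ((T + 1) * ?K)) / \<eta> + \<eta> / 2 * real ?K * real T)"
      using exp4_mistakes[of I c \<eta> f ?K zs] I_fin c \<eta> card_range ln_I zs by simp
  qed
  then show ?thesis by (rule that)
qed

section \<open>Tuning the learning rate\<close>

lemma ln_ge_half: "T \<ge> (2::nat) \<Longrightarrow> ln (real T) \<ge> 1 / 2"
proof -
  assume "T \<ge> 2"
  have "1 / 2 \<le> ln (2::real)" using ln2_ge_two_thirds by simp
  also have "\<dots> \<le> ln T" using \<open>T \<ge> 2\<close> by simp
  finally show ?thesis .
qed

lemma finite_dims_regret: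
  fixes H :: "('x \<Rightarrow> 'y) set"
  assumes T: "T \<ge> 2" and H: "H \<noteq> {}" and L: "littlestone_dim H = enat L" "L \<ge> 1"
    and B: "bandit_littlestone_dim H = enat B" "B \<ge> 1"
  obtains A :: "('x, 'y) bandit_learner" where
    "expected_regret A T H \<le> ereal (8 * sqrt (real L * real B * real T * ln (real T)))"
proof (cases "B + 1 \<ge> T")
  case True
  \<comment> \<open>Here \<open>B \<ge> T - 1 \<ge> T / 2\<close>; with
    \<open>ln T \<ge> 1 / 2\<close> the claimed bound is at least \<open>T\<close>, which no
    learner's mistakes exceed.\<close>
  have "1 * (real T / 2) \<le> real L * real B"
    using T L(2) True by (intro mult_mono) auto
  then have "1 * (real T / 2) * T \<le> real L * real B * T" by (rule mult_right_mono) simp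
  then have "real T / 2 * T \<le> real L * real B * real T" by simp
  then have "(real T / 2 * T) * (1 / 2) \<le> (real L * real B * real T) * ln (real T)"
    using ln_ge_half[OF T] by (rule mult_mono) auto
  then have "real T * real T \<le> 64 * (real L * real B * real T * ln (real T))"
    using zero_le_square[of "real T"] by linarith
  then have "real T \<le> sqrt (64 * (real L * real B * real T * ln (real T)))"
    by (intro real_le_rsqrt) (simp add: power2_eq_square)
  also have "\<dots> = 8 * sqrt (real L * real B * real T * ln (real T))" by (simp only: real_sqrt_mult) simp
  finally have le: "real T \<le> 8 * sqrt (real L * real B * real T * ln (real T))" .
  have "expected_regret (\<lambda>_ _. return_pmf undefined :: 'y pmf) T H \<le> ereal (8 * sqrt (real L * real B * real T * ln (real T)))"
  proof (rule expected_regret_leI)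
    fix zs :: "('x \<times> 'y) list" and h assume "length zs = T" "h \<in> H"
    then show "expected_mistakes (\<lambda>_ _. return_pmf undefined :: 'y pmf) zs
        \<le> hyp_loss h zs + 8 * sqrt (real L * real B * real T * ln (real T))"
      using expected_mistakes_le_length[of "\<lambda>_ _. return_pmf undefined" zs] le by simp
  qed
  then show ?thesis by (rule that)
next
  case False
  have lnT: "ln (real T) > 0" using T by simp
  define s where "s = sqrt (real L * real B * real T * ln (real T))"
  have s: "s > 0" unfolding s_def using T L B lnT by simp
  have s2: "s * s = real L * real B * real T * ln (real T)" unfolding s_def using T by simp
  \<comment> \<open>This is \<open>sqrt (L * ln T / (B * T))\<close>; it balances the two terms,
    which become at most \<open>2 * s\<close> and \<open>s\<close>.\<close>
  define \<eta> where "\<eta> = s / (B * T)"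
  have \<eta>: "\<eta> > 0" unfolding \<eta>_def using s B T by simp
  obtain A :: "('x, 'y) bandit_learner" where A: "expected_regret A T H
    \<le> ereal (real L * ln (real ((T + 1) * (B + 1))) / \<eta> + \<eta> / 2 * real (B + 1) * real T)"
    using exp4_soa_regret[OF H L(1) B(1) \<eta>] .
  \<comment> \<open>With \<open>B + 1 \<le> T - 1\<close> the product is at most
    \<open>T\<^sup>2 - 1\<close>, so its logarithm costs only \<open>2 * ln T\<close>.\<close>
  have "(T + 1) * (B + 1) \<le> (T + 1) * (T - 1)" using False by (intro mult_left_mono) auto
  also have "\<dots> \<le> T * T" by (cases T) auto
  finally have "real ((T + 1) * (B + 1)) \<le> real (T * T)" by (rule of_nat_mono)
  then have "ln ((T + 1) * (B + 1)) \<le> ln (real (T * T))"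
    by (intro ln_mono) (simp_all del: of_nat_mult)
  also have "\<dots> = 2 * ln T" using T by (simp add: ln_mult)
  finally have "real L * ln (real ((T + 1) * (B + 1))) / \<eta> \<le> L * (2 * ln T) / \<eta>"
    using \<eta> by (intro divide_right_mono mult_left_mono) auto
  also have "\<dots> = 2 * (s * s) / s" using B T s s2 by (simp add: \<eta>_def field_simps)
  also have "\<dots> = 2 * s" using s by simp
  finally have 1: "real L * ln (real ((T + 1) * (B + 1))) / \<eta> \<le> 2 * s" .
  have "\<eta> / 2 * real (B + 1) * real T \<le> \<eta> / 2 * (2 * B) * T"
    using \<eta> B by (intro mult_right_mono mult_left_mono) auto
  also have "\<dots> = s" using B T by (simp add: \<eta>_def)
  finally have "real L * ln (real ((T + 1) * (B + 1))) / \<eta> + \<eta> / 2 * real (B + 1) * real T \<le> 8 * s"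
    using 1 s by linarith
  then have "expected_regret A T H \<le> ereal (8 * s)"
    using order_trans[OF A] by simp
  then show ?thesis unfolding s_def by (rule that)
qed

theorem theorem2:
  fixes H :: "('x \<Rightarrow> 'y) set" and T :: nat
  assumes "T \<ge> 2"
  shows "\<exists>A :: ('x, 'y) bandit_learner.
    expected_regret A T H \<le>
      8 * ereal_sqrt (ereal_of_enat (littlestone_dim H) * ereal_of_enat (bandit_littlestone_dim H)
            * ereal (real T) * ereal (ln (real T)))"
proof -
  let ?P = "ereal_of_enat (littlestone_dim H) * ereal_of_enat (bandit_littlestone_dim H)
            * ereal (real T) * ereal (ln (real T))"
  have R_nonneg: "8 * ereal_sqrt ?P \<ge> 0"
    using assms by (intro ereal_0_le_mult ereal_sqrt_nonneg) (auto simp: ereal_of_enat_nonneg)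
  \<comment> \<open>Classes with at most one member have both dimensions \<open>0\<close>, hence
    bound \<open>0\<close>, and are treated directly.\<close>
  consider "H = {}" | h where "H = {h}" | h h' x where "h \<in> H" "h' \<in> H" "h x \<noteq> h' x"
    by (metis ext is_singletonI' is_singleton_def)
  then show ?thesis
  proof cases
    case 1
    then have "expected_regret (\<lambda>_ _. return_pmf undefined :: 'y pmf) T H \<le> ereal 0"
      by (intro expected_regret_leI) auto
    also have "ereal 0 \<le> 8 * ereal_sqrt ?P" using R_nonneg by (simp add: zero_ereal_def)
    finally show ?thesis by blast
  next
    case 2
    then show ?thesis using order_trans[OF deterministic_regret R_nonneg] by blast
  next
    case 3
    note ge1 = dims_ge_1[OF 3]
    show ?thesis
    proof (cases "littlestone_dim H = \<infinity> \<or> bandit_littlestone_dim H = \<infinity>")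
      case True
      have "ereal_of_enat (littlestone_dim H) > 0" "ereal_of_enat (bandit_littlestone_dim H) > 0"
        using ge1 by (auto simp: one_enat_def enat_0_iff intro!: less_le_trans[OF zero_less_one])
      \<comment> \<open>All other factors are positive, including \<open>ln T\<close> because
        \<open>T \<ge> 2\<close>, so the bound is infinite and any learner will do.\<close>
      then have "?P = \<infinity>" using True assms by auto
      then show ?thesis by (simp add: ereal_sqrt_def)
    next
      case False
      then obtain L B where LB: "littlestone_dim H = enat L" "bandit_littlestone_dim H = enat B"
        by auto
      with ge1 have "L \<ge> 1" "B \<ge> 1" by (auto simp: one_enat_def)
      moreover have "H \<noteq> {}" using 3 by auto
      ultimately obtain A :: "('x, 'y) bandit_learner" where
        "expected_regret A T H \<le> ereal (8 * sqrt (real L * real B * real T * ln (real T)))"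
        using finite_dims_regret[OF assms _ LB(1) _ LB(2)] by blast
      then show ?thesis by (auto simp: LB ereal_sqrt_def intro!: exI[of _ A])
    qed
  qed
qed

end
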